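(* Let $\breve{J}_4=M_{j\otimes1}$. Then reversion on $Cl(0,5)=M(4,\mathbb{C})$, with respect to the basis of $1$-vectors $$\hat f_1=(i\sigma_z)\otimes\sigma_x,\quad \hat f_2=I_2\otimes(i\sigma_z),\quad \hat f_3=-I_2\otimes(i\sigma_y),\quad \hat f_4=-(i\sigma_x)\otimes\sigma_x,\quad \hat f_5=(i\sigma_y)\otimes\sigma_x,$$ is given by $\Phi^{rev}(X)=\breve{J}_4^{-1}X^T\breve{J}_4$.
   Context: Pauli matrices: $\sigma_x=\begin{pmatrix}0&1\\1&0\end{pmatrix}$, $\sigma_y=\begin{pmatrix}0&-i\\i&0\end{pmatrix}$, $\sigma_z=\begin{pmatrix}1&0\\0&-1\end{pmatrix}$; $\otimes$ between matrices is the Kronecker product. For quaternions $p,q$, $M_{p\otimes q}\in M(4,\mathbb{R})$ is the matrix of $x\mapsto px\bar q$ on $\mathbb{H}\cong\mathbb{R}^4$ with respect to the basis $1,i,j,k$. $Cl(p,q)$ is the real Clifford algebra generated by $p+q$ pairwise anticommuting generators, $p$ of which square to $+1$ and $q$ to $-1$. To say that a set of matrices in a matrix algebra $\mathcal{A}$ (viewed as a real algebra) is a basis of $1$-vectors for $Cl(p,q)=\mathcal{A}$ means that they satisfy these relations and that $\mathcal{A}$ is thereby identified with $Cl(p,q)$; the space of $1$-vectors is their real span. Reversion is the unique real-linear anti-automorphism fixing $1$ and every $1$-vector. *)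

theory Defs
  imports
    "HOL-Analysis.Analysis"
    "HOL-Analysis.Finite_Function_Topology"
begin

section \<open>Pauli matrices and the Kronecker product\<close>

definition sigma_x :: "complex^2^2"
  where "sigma_x = vector [vector [0, 1], vector [1, 0]]"

definition sigma_y :: "complex^2^2"
  where "sigma_y = vector [vector [0, - \<i>], vector [\<i>, 0]]"

definition sigma_z :: "complex^2^2"
  where "sigma_z = vector [vector [1, 0], vector [0, - 1]]"

text \<open>The indices 1, 2, 3, 4 of a vector of length 4 correspond, in this order, to the
  pairs (1,1), (1,2), (2,1), (2,2). In the numeral types 2 = 0 and 4 = 0 hold, but following
  \<^const>\<open>vector\<close> the element 0 is always read as the last index.\<close>

definition block_index :: "4 \<Rightarrow> 2"
  where "block_index i = (if i = 1 \<or> i = 2 then 1 else 2)"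

definition inner_index :: "4 \<Rightarrow> 2"
  where "inner_index i = (if i = 1 \<or> i = 3 then 1 else 2)"

definition kronecker :: "'a::times^2^2 \<Rightarrow> 'a^2^2 \<Rightarrow> 'a^4^4"
  where "kronecker A B =
    (\<chi> i j. A $ block_index i $ block_index j * B $ inner_index i $ inner_index j)"


section \<open>Quaternions\<close>

text \<open>A quaternion is represented by its coordinates with respect to 1, i, j, k.\<close>

type_synonym quat = "real^4"

definition quat_1 :: quat where "quat_1 = axis 1 1"
definition quat_i :: quat where "quat_i = axis 2 1"
definition quat_j :: quat where "quat_j = axis 3 1"
definition quat_k :: quat where "quat_k = axis 4 1"

definition quat_mult :: "quat \<Rightarrow> quat \<Rightarrow> quat"
  where "quat_mult p q = vector
    [p$1 * q$1 - p$2 * q$2 - p$3 * q$3 - p$4 * q$4,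
     p$1 * q$2 + p$2 * q$1 + p$3 * q$4 - p$4 * q$3,
     p$1 * q$3 - p$2 * q$4 + p$3 * q$1 + p$4 * q$2,
     p$1 * q$4 + p$2 * q$3 - p$3 * q$2 + p$4 * q$1]"

definition quat_cnj :: "quat \<Rightarrow> quat"
  where "quat_cnj q = vector [q$1, - q$2, - q$3, - q$4]"

definition quat_tensor_matrix :: "quat \<Rightarrow> quat \<Rightarrow> real^4^4"
  where "quat_tensor_matrix p q = matrix (\<lambda>x. quat_mult (quat_mult p x) (quat_cnj q))"

lemma vector_4:
  "(vector [a, b, c, d] :: 'a::zero^4) $ 1 = a"
  "(vector [a, b, c, d] :: 'a::zero^4) $ 2 = b"
  "(vector [a, b, c, d] :: 'a::zero^4) $ 3 = c"
  "(vector [a, b, c, d] :: 'a::zero^4) $ 4 = d"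
  by (simp_all add: vector_def)

lemma quat_relations:
  "quat_mult quat_i quat_i = - quat_1"
  "quat_mult quat_j quat_j = - quat_1"
  "quat_mult quat_k quat_k = - quat_1"
  "quat_mult (quat_mult quat_i quat_j) quat_k = - quat_1"
  by (simp_all add: vec_eq_iff forall_4 quat_mult_def vector_4 axis_def
      quat_1_def quat_i_def quat_j_def quat_k_def)


section \<open>The real Clifford algebra\<close>

text \<open>
  Cl(p,q) is the real algebra with generators numbered 0, ..., p + q - 1 and the Clifford
  relations, i.e. the quotient of the free algebra on these generators by a two-sided ideal.
  Elements of the free algebra are finitely supported functions from words (lists of
  generators) to real coefficients.
\<close>

definition free_algebra :: "nat \<Rightarrow> (nat list \<Rightarrow>\<^sub>0 real) set"
  where "free_algebra n = {P. Poly_Mapping.keys P \<subseteq> lists {..<n}}"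

definition generator_square :: "nat \<Rightarrow> nat \<Rightarrow> real"
  where "generator_square p i = (if i < p then 1 else - 1)"

text \<open>
  The two-sided ideal generated by the relators e_i e_j + e_j e_i (for distinct i, j) and
  e_i e_i - s_i 1, where s_i is the prescribed square. It is the real span of the products
  u r v of a relator r with words u and v.
\<close>

definition clifford_ideal :: "nat \<Rightarrow> nat \<Rightarrow> (nat list \<Rightarrow>\<^sub>0 real) set"
  where "clifford_ideal p q = span
    ({Poly_Mapping.single (u @ [i, j] @ v) 1 + Poly_Mapping.single (u @ [j, i] @ v) 1 | u i j v.
        u \<in> lists {..<p + q} \<and> v \<in> lists {..<p + q} \<and> i < p + q \<and> j < p + q \<and> i \<noteq> j} \<union>
     {Poly_Mapping.single (u @ [i, i] @ v) 1 - Poly_Mapping.single (u @ v) (generator_square p i)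
        | u i v. u \<in> lists {..<p + q} \<and> v \<in> lists {..<p + q} \<and> i < p + q})"

text \<open>
  The algebra homomorphism from the free algebra to the matrix algebra that sends the i-th
  generator to the i-th matrix of the list. The product of matrices is \<open>**\<close>; the operations
  \<open>*\<close> and \<open>1\<close> on the vector type are componentwise.
\<close>

definition eval_word :: "('a::real_algebra_1^'n^'n) list \<Rightarrow> nat list \<Rightarrow> 'a^'n^'n"
  where "eval_word fs w = foldr (\<lambda>i A. fs ! i ** A) w (mat 1)"

definition eval_free :: "('a::real_algebra_1^'n^'n) list \<Rightarrow> (nat list \<Rightarrow>\<^sub>0 real) \<Rightarrow> 'a^'n^'n"
  where "eval_free fs P = (\<Sum>w\<in>Poly_Mapping.keys P. Poly_Mapping.lookup P w *\<^sub>R eval_word fs w)"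

text \<open>
  The matrices satisfy the Clifford relations (the first \<open>p\<close> of them squaring to +1, the
  remaining \<open>q\<close> to -1), and the induced homomorphism from Cl(p,q) to the full matrix algebra
  is an isomorphism: \<^const>\<open>eval_free\<close> is onto and its kernel is exactly
  \<^const>\<open>clifford_ideal\<close>.
\<close>

definition basis_of_1_vectors :: "nat \<Rightarrow> nat \<Rightarrow> ('a::real_algebra_1^'n^'n) list \<Rightarrow> bool"
  where "basis_of_1_vectors p q fs \<longleftrightarrow>
    length fs = p + q \<and>
    (\<forall>i<p + q. fs ! i ** fs ! i = generator_square p i *\<^sub>R mat 1) \<and>
    (\<forall>i<p + q. \<forall>j<p + q. i \<noteq> j \<longrightarrow> fs ! i ** fs ! j = - (fs ! j ** fs ! i)) \<and>
    eval_free fs ` free_algebra (p + q) = UNIV \<and>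
    {P \<in> free_algebra (p + q). eval_free fs P = 0} = clifford_ideal p q"


section \<open>Reversion\<close>

definition anti_automorphism :: "('a::real_algebra_1^'n^'n \<Rightarrow> 'a^'n^'n) \<Rightarrow> bool"
  where "anti_automorphism \<Phi> \<longleftrightarrow>
    linear \<Phi> \<and> bij \<Phi> \<and> (\<forall>X Y. \<Phi> (X ** Y) = \<Phi> Y ** \<Phi> X)"

definition is_reversion :: "('a::real_algebra_1^'n^'n) list \<Rightarrow> ('a^'n^'n \<Rightarrow> 'a^'n^'n) \<Rightarrow> bool"
  where "is_reversion fs \<Phi> \<longleftrightarrow>
    anti_automorphism \<Phi> \<and> \<Phi> (mat 1) = mat 1 \<and> (\<forall>v\<in>span (set fs). \<Phi> v = v)"

definition reversion :: "('a::real_algebra_1^'n^'n) list \<Rightarrow> 'a^'n^'n \<Rightarrow> 'a^'n^'n"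
  where "reversion fs = (THE \<Phi>. is_reversion fs \<Phi>)"


section \<open>The matrices of the statement\<close>

definition fhat_1 :: "complex^4^4"
  where "fhat_1 = kronecker (map_matrix ((*) \<i>) sigma_z) sigma_x"

definition fhat_2 :: "complex^4^4"
  where "fhat_2 = kronecker (mat 1) (map_matrix ((*) \<i>) sigma_z)"

definition fhat_3 :: "complex^4^4"
  where "fhat_3 = kronecker (- mat 1) (map_matrix ((*) \<i>) sigma_y)"

definition fhat_4 :: "complex^4^4"
  where "fhat_4 = kronecker (- map_matrix ((*) \<i>) sigma_x) sigma_x"

definition fhat_5 :: "complex^4^4"
  where "fhat_5 = kronecker (map_matrix ((*) \<i>) sigma_y) sigma_x"

definition fhat :: "(complex^4^4) list"
  where "fhat = [fhat_1, fhat_2, fhat_3, fhat_4, fhat_5]"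

definition J_breve :: "complex^4^4"
  where "J_breve = map_matrix complex_of_real (quat_tensor_matrix quat_j quat_1)"

end

theory Submission
  imports Defs
begin

text \<open>Modulo the Clifford relations every word is a multiple of a strictly increasing one, so the
  Clifford algebra has dimension at most \<open>2 ^ 5 = 32\<close>. The matrices satisfy the relations and
  generate M(4,C), of real dimension 32, whence the isomorphism. An anti-automorphism is
  determined by its values on generators, and \<open>X \<mapsto> J\<^sup>-\<^sup>1 X\<^sup>T J\<close> is one that fixes each generator.\<close>

section \<open>The free algebra\<close>

lemma lookup_scaleR_poly_mapping [simp]:
  "Poly_Mapping.lookup (r *\<^sub>R P) w = r *\<^sub>R Poly_Mapping.lookup P w"
proof -
  have "finite {i. r *\<^sub>R Poly_Mapping.lookup P i \<noteq> 0}"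
    by (rule finite_subset[OF _ finite_lookup[of P]]) auto
  then show ?thesis
    by (simp add: scaleR_poly_mapping_def Abs_poly_mapping_inverse)
qed

lemma scaleR_single:
  "r *\<^sub>R Poly_Mapping.single w s = Poly_Mapping.single w (r *\<^sub>R s)"
  by (rule poly_mapping_eqI) (simp add: lookup_single when_def)

text \<open>Supports may shrink under addition and scaling; a common finite index set makes the
  evaluation sums comparable term by term.\<close>

lemma eval_free_superset:
  assumes "finite K" "Poly_Mapping.keys P \<subseteq> K"
  shows "eval_free fs P = (\<Sum>w\<in>K. Poly_Mapping.lookup P w *\<^sub>R eval_word fs w)"
  unfolding eval_free_def
  by (rule sum.mono_neutral_left) (use assms in \<open>auto simp: in_keys_iff\<close>)

lemma linear_eval_free: "linear (eval_free fs)"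
proof (rule linearI)
  fix P Q :: "nat list \<Rightarrow>\<^sub>0 real" and r :: real
  let ?K = "Poly_Mapping.keys P \<union> Poly_Mapping.keys Q"
  show "eval_free fs (P + Q) = eval_free fs P + eval_free fs Q"
    by (simp add: eval_free_superset[of ?K] keys_add lookup_add scaleR_add_left sum.distrib)
  have "Poly_Mapping.keys (r *\<^sub>R P) \<subseteq> Poly_Mapping.keys P"
    by (auto simp: in_keys_iff)
  then show "eval_free fs (r *\<^sub>R P) = r *\<^sub>R eval_free fs P"
    by (simp add: eval_free_superset[of "Poly_Mapping.keys P"] scaleR_sum_right)
qed

lemma eval_free_single: "eval_free fs (Poly_Mapping.single w r) = r *\<^sub>R eval_word fs w"
  by (simp add: eval_free_superset[of "{w}"])

lemma subspace_free_algebra: "subspace (free_algebra n)"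
proof (rule subspaceI)
  show "0 \<in> free_algebra n"
    by (simp add: free_algebra_def)
  show "P + Q \<in> free_algebra n" if "P \<in> free_algebra n" "Q \<in> free_algebra n" for P Q
    using that keys_add[of P Q] by (simp add: free_algebra_def) blast
  show "r *\<^sub>R P \<in> free_algebra n" if "P \<in> free_algebra n" for r P
  proof -
    have "Poly_Mapping.keys (r *\<^sub>R P) \<subseteq> Poly_Mapping.keys P"
      by (auto simp: in_keys_iff)
    with that show ?thesis by (simp add: free_algebra_def)
  qed
qed

text \<open>With this description, a claim that defines a subspace has to be checked on words
  only.\<close>

lemma free_algebra_eq_span:
  "free_algebra n = span ((\<lambda>w. Poly_Mapping.single w 1) ` lists {..<n})"
proof
  show "span ((\<lambda>w. Poly_Mapping.single w (1::real)) ` lists {..<n}) \<subseteq> free_algebra n"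
    by (rule span_minimal[OF _ subspace_free_algebra]) (auto simp: free_algebra_def)
  show "free_algebra n \<subseteq> span ((\<lambda>w. Poly_Mapping.single w (1::real)) ` lists {..<n})"
  proof
    fix P assume "P \<in> free_algebra n"
    then have K: "Poly_Mapping.keys P \<subseteq> lists {..<n}"
      by (simp add: free_algebra_def)
    have "P = (\<Sum>w\<in>Poly_Mapping.keys P. Poly_Mapping.lookup P w *\<^sub>R Poly_Mapping.single w 1)"
      by (rule poly_mapping_eqI)
        (simp add: lookup_sum lookup_single when_def in_keys_iff if_distrib cong: if_cong)
    also have "\<dots> \<in> span ((\<lambda>w. Poly_Mapping.single w 1) ` lists {..<n})"
      using K by (intro span_sum span_scale span_base) auto
    finally show "P \<in> span ((\<lambda>w. Poly_Mapping.single w 1) ` lists {..<n})" .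
  qed
qed

lemma eval_free_image:
  "eval_free fs ` free_algebra n = span (eval_word fs ` lists {..<n})"
  unfolding free_algebra_eq_span
  by (simp add: linear_span_image[OF linear_eval_free, symmetric] image_image eval_free_single)


section \<open>Subalgebras of matrix algebras\<close>

lemma scaleR_matrix_mult_left:
  "(r *\<^sub>R A) ** B = r *\<^sub>R (A ** (B :: 'a::real_algebra_1^'n^'n))"
  by (simp add: vec_eq_iff matrix_matrix_mult_def scaleR_sum_right)

lemma scaleR_matrix_mult_right:
  "A ** (r *\<^sub>R B) = r *\<^sub>R (A ** (B :: 'a::real_algebra_1^'n^'n))"
  by (simp add: vec_eq_iff matrix_matrix_mult_def scaleR_sum_right)

lemma linear_matrix_mult_left: "linear (\<lambda>A. A ** (B :: 'a::real_algebra_1^'n^'n))"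
proof (rule linearI)
  show "(A + C) ** B = A ** B + C ** B" for A C
    by (simp add: vec_eq_iff matrix_matrix_mult_def distrib_right sum.distrib)
qed (rule scaleR_matrix_mult_left)

lemma linear_matrix_mult_right: "linear (\<lambda>B. A ** (B :: 'a::real_algebra_1^'n^'n))"
  by (rule linearI) (simp_all add: scaleR_matrix_mult_right matrix_add_ldistrib)

lemma eval_word_Nil [simp]: "eval_word fs [] = mat 1"
  and eval_word_Cons [simp]: "eval_word fs (i # w) = fs ! i ** eval_word fs w"
  by (simp_all add: eval_word_def)

lemma eval_word_append: "eval_word fs (u @ v) = eval_word fs u ** eval_word fs v"
  by (induction u) (simp_all add: matrix_mul_assoc)

text \<open>Concatenation of words multiplies their values; bilinearity carries this to the span,
  one factor at a time.\<close>

lemma span_eval_word_mult: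
  assumes "A \<in> span (eval_word fs ` lists L)" "B \<in> span (eval_word fs ` lists L)"
  shows "A ** B \<in> span (eval_word fs ` lists L)"
proof -
  let ?S = "span (eval_word fs ` lists L)"
  have word: "eval_word fs u ** B \<in> ?S" if u: "u \<in> lists L" for u
  proof -
    have "?S \<subseteq> {B. eval_word fs u ** B \<in> ?S}"
    proof (rule span_minimal)
      show "subspace {B. eval_word fs u ** B \<in> ?S}"
        using linear_subspace_vimage[OF linear_matrix_mult_right subspace_span]
        by (simp add: vimage_def)
      show "eval_word fs ` lists L \<subseteq> {B. eval_word fs u ** B \<in> ?S}"
      proof (rule image_subsetI, rule CollectI)
        fix v assume "v \<in> lists L"
        then show "eval_word fs u ** eval_word fs v \<in> ?S"
          using u by (auto simp: eval_word_append[symmetric] simp del: in_lists_conv_set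
              intro!: span_base imageI)
      qed
    qed
    then show ?thesis using assms(2) by blast
  qed
  have "?S \<subseteq> {A. A ** B \<in> ?S}"
  proof (rule span_minimal)
    show "subspace {A. A ** B \<in> ?S}"
      using linear_subspace_vimage[OF linear_matrix_mult_left subspace_span]
      by (simp add: vimage_def)
    show "eval_word fs ` lists L \<subseteq> {A. A ** B \<in> ?S}"
      using word by blast
  qed
  then show ?thesis using assms(1) by blast
qed


section \<open>Normal words in the Clifford algebra\<close>

text \<open>These words encode the standard Clifford monomials, one for each subset of the
  generators.\<close>

definition normal_words :: "nat \<Rightarrow> nat list set"
  where "normal_words n = {w \<in> lists {..<n}. sorted_wrt (<) w}"

text \<open>A strictly increasing list is determined by its set of entries.\<close>

lemma normal_words_finite: "finite (normal_words n)"
  and normal_words_card: "card (normal_words n) \<le> 2 ^ n"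
proof -
  have inj: "inj_on set (normal_words n)"
    by (rule inj_onI) (auto simp: normal_words_def intro: strict_sorted_equal)
  have sub: "set ` normal_words n \<subseteq> Pow {..<n}"
    by (auto simp: normal_words_def)
  show "finite (normal_words n)"
    by (rule inj_on_finite[OF inj sub]) simp
  show "card (normal_words n) \<le> 2 ^ n"
    using card_inj_on_le[OF inj sub] by (simp add: card_Pow)
qed

section \<open>Congruence of words modulo the Clifford ideal\<close>

lemma clifford_ideal_refl: "P - 1 *\<^sub>R P \<in> clifford_ideal p q"
  by (simp add: clifford_ideal_def span_zero)

text \<open>Membership of \<open>P - c *\<^sub>R Q\<close> is read as the congruence of
  \<open>P\<close> to a multiple of \<open>Q\<close>; along a chain the scalars multiply.\<close>

lemma clifford_ideal_trans:
  assumes "P - c *\<^sub>R Q \<in> clifford_ideal p q" "Q - d *\<^sub>R R \<in> clifford_ideal p q"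
  shows "P - (c * d) *\<^sub>R R \<in> clifford_ideal p q"
proof -
  have "(P - c *\<^sub>R Q) + c *\<^sub>R (Q - d *\<^sub>R R) \<in> clifford_ideal p q"
    using assms unfolding clifford_ideal_def by (intro span_add span_scale)
  then show ?thesis by (simp add: algebra_simps)
qed

lemma clifford_ideal_swap:
  assumes "u \<in> lists {..<p + q}" "v \<in> lists {..<p + q}" "i < p + q" "j < p + q" "i \<noteq> j"
  shows "Poly_Mapping.single (u @ i # j # v) 1 - (-1) *\<^sub>R Poly_Mapping.single (u @ j # i # v) 1
    \<in> clifford_ideal p q"
  unfolding clifford_ideal_def
  by (intro span_base UnI1 CollectI exI[of _ u] exI[of _ i] exI[of _ j] exI[of _ v] conjI)
    (use assms in simp_all)

lemma clifford_ideal_square: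
  assumes "u \<in> lists {..<p + q}" "v \<in> lists {..<p + q}" "i < p + q"
  shows "Poly_Mapping.single (u @ i # i # v) 1
      - generator_square p i *\<^sub>R Poly_Mapping.single (u @ v) 1 \<in> clifford_ideal p q"
  unfolding clifford_ideal_def
  by (intro span_base UnI2 CollectI exI[of _ u] exI[of _ i] exI[of _ v] conjI)
    (use assms in \<open>simp_all add: scaleR_single\<close>)

text \<open>The arbitrary left context u replaces closure of the ideal under left multiplication.\<close>

lemma insert_normal_word:
  assumes "v \<in> normal_words (p + q)" "i < p + q"
  shows "\<exists>v'\<in>normal_words (p + q). set v' \<subseteq> insert i (set v) \<and>
    (\<exists>c. \<forall>u\<in>lists {..<p + q}.
      Poly_Mapping.single (u @ i # v) 1 - c *\<^sub>R Poly_Mapping.single (u @ v') 1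
        \<in> clifford_ideal p q)"
  using assms(1)
proof (induction v)
  case Nil
  have "[i] \<in> normal_words (p + q)"
    using assms(2) by (simp add: normal_words_def)
  then show ?case
    by (intro bexI[of _ "[i]"] conjI exI[of _ 1] ballI clifford_ideal_refl) simp_all
next
  case (Cons a v)
  have v: "v \<in> normal_words (p + q)" "v \<in> lists {..<p + q}" and a: "a < p + q"
    and av: "\<forall>b\<in>set v. a < b"
    using Cons.prems by (auto simp: normal_words_def)
  consider "i < a" | "i = a" | "a < i" by linarith
  then show ?case
  proof cases
    case 1
    then have "i # a # v \<in> normal_words (p + q)"
      using Cons.prems assms(2) av by (auto simp: normal_words_def)
    then show ?thesis
      by (intro bexI[of _ "i # a # v"] conjI exI[of _ 1] ballI clifford_ideal_refl) simp_all
  next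
    case 2
    then show ?thesis
      using v assms(2)
      by (intro bexI[of _ v] conjI exI[of _ "generator_square p i"] ballI)
        (simp_all add: clifford_ideal_square subset_insertI2 del: in_lists_conv_set)
  next
    case 3
    \<comment> \<open>A letter larger than \<open>a\<close> moves past \<open>a\<close> at the cost
      of a sign and is then inserted into the tail.\<close>
    from Cons.IH[OF v(1)] obtain v' c where v': "v' \<in> normal_words (p + q)"
      "set v' \<subseteq> insert i (set v)"
      and c: "\<And>u. u \<in> lists {..<p + q} \<Longrightarrow>
        Poly_Mapping.single (u @ i # v) 1 - c *\<^sub>R Poly_Mapping.single (u @ v') 1
          \<in> clifford_ideal p q"
      by blast
    \<comment> \<open>The bound on \<open>set v'\<close> is used here: entries of \<open>v'\<close>
      are \<open>i\<close> or come from \<open>v\<close>, so all of them exceed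
      \<open>a\<close>.\<close>
    have "a # v' \<in> normal_words (p + q)"
      using v' av a 3 by (auto simp: normal_words_def)
    moreover have "Poly_Mapping.single (u @ i # a # v) 1
        - (- 1 * c) *\<^sub>R Poly_Mapping.single (u @ a # v') 1 \<in> clifford_ideal p q"
      if u: "u \<in> lists {..<p + q}" for u
    proof (rule clifford_ideal_trans)
      show "Poly_Mapping.single (u @ i # a # v) 1
          - (-1) *\<^sub>R Poly_Mapping.single (u @ a # i # v) 1 \<in> clifford_ideal p q"
        using u v(2) assms(2) a 3 by (intro clifford_ideal_swap) auto
      show "Poly_Mapping.single (u @ a # i # v) 1
          - c *\<^sub>R Poly_Mapping.single (u @ a # v') 1 \<in> clifford_ideal p q"
        using c[of "u @ [a]"] u a by simp
    qed
    ultimately show ?thesis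
      using v'(2) by (intro bexI[of _ "a # v'"] conjI exI[of _ "- 1 * c"] ballI) fastforce+
  qed
qed

text \<open>Insertion sort: the tail is normalized first, in a left context extended by the head,
  and then the head is inserted.\<close>

lemma normal_form:
  assumes "w \<in> lists {..<p + q}"
  shows "\<exists>v\<in>normal_words (p + q). \<exists>c. \<forall>u\<in>lists {..<p + q}.
      Poly_Mapping.single (u @ w) 1 - c *\<^sub>R Poly_Mapping.single (u @ v) 1
        \<in> clifford_ideal p q"
  using assms
proof (induction w)
  case Nil
  have "[] \<in> normal_words (p + q)"
    by (simp add: normal_words_def)
  then show ?case
    by (intro bexI[of _ "[]"] exI[of _ 1] ballI clifford_ideal_refl)
next
  case (Cons i w)
  then have i: "i < p + q"
    by simp
  from Cons.IH obtain v c where v: "v \<in> normal_words (p + q)"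
    and c: "\<And>u. u \<in> lists {..<p + q} \<Longrightarrow>
      Poly_Mapping.single (u @ w) 1 - c *\<^sub>R Poly_Mapping.single (u @ v) 1
        \<in> clifford_ideal p q"
    by blast
  from insert_normal_word[OF v i] obtain v' d where v': "v' \<in> normal_words (p + q)"
    and d: "\<And>u. u \<in> lists {..<p + q} \<Longrightarrow>
      Poly_Mapping.single (u @ i # v) 1 - d *\<^sub>R Poly_Mapping.single (u @ v') 1
        \<in> clifford_ideal p q"
    by blast
  have "Poly_Mapping.single (u @ i # w) 1 - (c * d) *\<^sub>R Poly_Mapping.single (u @ v') 1
        \<in> clifford_ideal p q" if u: "u \<in> lists {..<p + q}" for u
  proof (rule clifford_ideal_trans)
    show "Poly_Mapping.single (u @ i # w) 1 - c *\<^sub>R Poly_Mapping.single (u @ i # v) 1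
        \<in> clifford_ideal p q"
      using c[of "u @ [i]"] u i by simp
    show "Poly_Mapping.single (u @ i # v) 1 - d *\<^sub>R Poly_Mapping.single (u @ v') 1
        \<in> clifford_ideal p q"
      using d[OF u] .
  qed
  with v' show ?case
    by (intro bexI[of _ v'] exI[of _ "c * d"] ballI)
qed

text \<open>The sums of normal combinations and ideal elements form a subspace containing every
  word. The quotient is thus spanned by the normal words.\<close>

lemma free_algebra_normal_form:
  assumes "P \<in> free_algebra (p + q)"
  obtains R where "R \<in> span ((\<lambda>w. Poly_Mapping.single w 1) ` normal_words (p + q))"
    and "P - R \<in> clifford_ideal p q"
proof -
  let ?N = "span ((\<lambda>w. Poly_Mapping.single w (1::real)) ` normal_words (p + q))"
  have "free_algebra (p + q) \<subseteq> {R + I | R I. R \<in> ?N \<and> I \<in> clifford_ideal p q}"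
    unfolding free_algebra_eq_span
  proof (rule span_minimal)
    show "subspace {R + I | R I. R \<in> ?N \<and> I \<in> clifford_ideal p q}"
      unfolding clifford_ideal_def by (intro subspace_sums subspace_span)
    show "(\<lambda>w. Poly_Mapping.single w 1) ` lists {..<p + q}
        \<subseteq> {R + I | R I. R \<in> ?N \<and> I \<in> clifford_ideal p q}"
    proof (rule image_subsetI)
      fix w :: "nat list" assume "w \<in> lists {..<p + q}"
      from normal_form[OF this] obtain v c where v: "v \<in> normal_words (p + q)"
        and "\<forall>u\<in>lists {..<p + q}. Poly_Mapping.single (u @ w) 1
          - c *\<^sub>R Poly_Mapping.single (u @ v) 1 \<in> clifford_ideal p q"
        by blast
      then have I: "Poly_Mapping.single w 1 - c *\<^sub>R Poly_Mapping.single v 1 \<in> clifford_ideal p q"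
        by (metis append_Nil lists.Nil)
      have "c *\<^sub>R Poly_Mapping.single v 1 \<in> ?N"
        using v by (intro span_scale span_base) auto
      then have "c *\<^sub>R Poly_Mapping.single v 1
          + (Poly_Mapping.single w 1 - c *\<^sub>R Poly_Mapping.single v 1)
        \<in> {R + I | R I. R \<in> ?N \<and> I \<in> clifford_ideal p q}"
        using I by blast
      then show "Poly_Mapping.single w 1 \<in> {R + I | R I. R \<in> ?N \<and> I \<in> clifford_ideal p q}"
        by simp
    qed
  qed
  with assms obtain R I where "P = R + I" "R \<in> ?N" "I \<in> clifford_ideal p q"
    by blast
  with that show thesis by simp
qed

section \<open>Evaluation and its kernel\<close>

lemma clifford_ideal_subset_free_algebra: "clifford_ideal p q \<subseteq> free_algebra (p + q)"
  unfolding clifford_ideal_def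
proof (rule span_minimal[OF _ subspace_free_algebra], safe)
  fix u v :: "nat list" and i j
  assume "\<forall>k\<in>set u. k \<in> {..<p + q}" "\<forall>k\<in>set v. k \<in> {..<p + q}" "i < p + q" "j < p + q"
  then show "Poly_Mapping.single (u @ [i, j] @ v) 1 + Poly_Mapping.single (u @ [j, i] @ v) 1
      \<in> free_algebra (p + q)"
    by (intro subspace_add subspace_free_algebra) (auto simp: free_algebra_def)
next
  fix u v :: "nat list" and i
  assume "\<forall>k\<in>set u. k \<in> {..<p + q}" "\<forall>k\<in>set v. k \<in> {..<p + q}" "i < p + q"
  then show "Poly_Mapping.single (u @ [i, i] @ v) 1
      - Poly_Mapping.single (u @ v) (generator_square p i) \<in> free_algebra (p + q)"
    by (intro subspace_diff subspace_free_algebra) (auto simp: free_algebra_def)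
qed

text \<open>The kernel is a subspace, so relators in context suffice; there concatenation becomes a
  product and the assumed relations cancel the middle factors.\<close>

lemma eval_free_clifford_ideal:
  assumes sq: "\<And>i. i < p + q \<Longrightarrow> fs ! i ** fs ! i = generator_square p i *\<^sub>R mat 1"
    and anti: "\<And>i j. i < p + q \<Longrightarrow> j < p + q \<Longrightarrow> i \<noteq> j \<Longrightarrow>
      fs ! i ** fs ! j = - (fs ! j ** fs ! i)"
    and P: "P \<in> clifford_ideal p q"
  shows "eval_free fs P = 0"
proof -
  have minus: "(- A) ** B = - (A ** B)" "B ** (- A) = - (B ** A)" for A B :: "'a^'b^'b"
    using linear_neg[OF linear_matrix_mult_left] linear_neg[OF linear_matrix_mult_right] by auto
  have "clifford_ideal p q \<subseteq> {P. eval_free fs P = 0}"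
    unfolding clifford_ideal_def
  proof (rule span_minimal[OF _ linear_subspace_kernel[OF linear_eval_free]], safe)
    fix u v :: "nat list" and i j
    assume "i < p + q" "j < p + q" "i \<noteq> j"
    then show "eval_free fs (Poly_Mapping.single (u @ [i, j] @ v) 1
        + Poly_Mapping.single (u @ [j, i] @ v) 1) = 0"
      by (simp add: linear_add[OF linear_eval_free] eval_free_single eval_word_append
          matrix_mul_assoc[of "fs ! _" "fs ! _"] anti[of i j] minus)
  next
    fix u v :: "nat list" and i
    assume "i < p + q"
    then show "eval_free fs (Poly_Mapping.single (u @ [i, i] @ v) 1
        - Poly_Mapping.single (u @ v) (generator_square p i)) = 0"
      by (simp add: linear_diff[OF linear_eval_free] eval_free_single eval_word_append
          matrix_mul_assoc[of "fs ! _" "fs ! _"] sq scaleR_matrix_mult_left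
          scaleR_matrix_mult_right)
  qed
  with P show ?thesis by blast
qed

text \<open>There are at most \<open>2 ^ (p + q)\<close> normal words, so when their values span an algebra of
  that dimension these values are linearly independent, which bounds the kernel from above.\<close>

lemma basis_of_1_vectorsI:
  fixes fs :: "('a::{real_algebra_1, euclidean_space}^'n^'n) list"
  assumes len: "length fs = p + q"
    and sq: "\<And>i. i < p + q \<Longrightarrow> fs ! i ** fs ! i = generator_square p i *\<^sub>R mat 1"
    and anti: "\<And>i j. i < p + q \<Longrightarrow> j < p + q \<Longrightarrow> i \<noteq> j \<Longrightarrow>
      fs ! i ** fs ! j = - (fs ! j ** fs ! i)"
    and surj: "span (eval_word fs ` lists {..<p + q}) = UNIV"
    and dim: "DIM('a^'n^'n) = 2 ^ (p + q)"
  shows "basis_of_1_vectors p q fs"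
proof -
  note lin = linear_eval_free[of fs]
  have ideal_0: "eval_free fs P = 0" if "P \<in> clifford_ideal p q" for P
    by (rule eval_free_clifford_ideal[OF sq anti that])
  define B where "B = (\<lambda>w. Poly_Mapping.single w (1::real)) ` normal_words (p + q)"
  have finB: "finite B"
    by (simp add: B_def normal_words_finite)
  have cardB: "card B \<le> DIM('a^'n^'n)"
    using card_image_le[OF normal_words_finite] normal_words_card[of "p + q"] le_trans
    unfolding B_def dim by blast
  have span_image: "span (eval_free fs ` B) = UNIV"
  proof -
    \<comment> \<open>Subtracting an ideal element from a preimage keeps its value, so a normal
      preimage exists.\<close>
    have "A \<in> eval_free fs ` span B" for A
    proof -
      have "A \<in> eval_free fs ` free_algebra (p + q)"
        by (simp add: eval_free_image surj)
      then obtain P where P: "P \<in> free_algebra (p + q)" "A = eval_free fs P"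
        by blast
      from free_algebra_normal_form[OF P(1)] obtain R where R: "R \<in> span B"
        and "P - R \<in> clifford_ideal p q"
        unfolding B_def by blast
      then have "eval_free fs P = eval_free fs R"
        using ideal_0[where P = "P - R"] by (simp add: linear_diff[OF lin])
      with P R show ?thesis by blast
    qed
    then show ?thesis
      by (auto simp: linear_span_image[OF lin])
  qed
  \<comment> \<open>A spanning set has at least as many elements as the dimension, while this image
    has at most \<open>card B\<close>, which is at most the dimension. All these bounds are
    therefore equalities.\<close>
  have card_image: "card (eval_free fs ` B) = card B"
    and card_dim: "card (eval_free fs ` B) = DIM('a^'n^'n)"
    using span_card_ge_dim[of "eval_free fs ` B" UNIV] span_image finB cardB
      card_image_le[OF finB, of "eval_free fs"] by auto
  have inj: "inj_on (eval_free fs) B"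
    using eq_card_imp_inj_on[OF finB card_image] .
  have indep: "independent (eval_free fs ` B)"
    by (rule card_le_dim_spanning[of _ UNIV]) (use span_image finB card_dim in auto)
  have ker: "R = 0" if "R \<in> span B" "eval_free fs R = 0" for R
    using linear_indep_image_lemma[OF lin finB indep inj that] .
  \<comment> \<open>The normal part of a kernel element lies in the kernel as well, hence is zero,
    and only the ideal part remains.\<close>
  have "P \<in> clifford_ideal p q" if P: "P \<in> free_algebra (p + q)" "eval_free fs P = 0" for P
  proof -
    from free_algebra_normal_form[OF P(1)] obtain R where R: "R \<in> span B"
      and PR: "P - R \<in> clifford_ideal p q"
      unfolding B_def by blast
    have "eval_free fs R = 0"
      using ideal_0[OF PR] P(2) by (simp add: linear_diff[OF lin])
    with ker R have "R = 0" by blast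
    with PR show ?thesis by simp
  qed
  then have "{P \<in> free_algebra (p + q). eval_free fs P = 0} = clifford_ideal p q"
    using clifford_ideal_subset_free_algebra ideal_0 by blast
  with len surj show ?thesis
    unfolding basis_of_1_vectors_def eval_free_image by (intro conjI allI impI sq anti)
qed


section \<open>Reversion\<close>

text \<open>Anti-multiplicativity determines the value on each word from the fixed generators, and
  linearity does the rest.\<close>

lemma is_reversion_unique:
  assumes surj: "span (eval_word fs ` lists {..<length fs}) = UNIV"
    and \<Phi>: "is_reversion fs \<Phi>" and \<Psi>: "is_reversion fs \<Psi>"
  shows "\<Phi> = \<Psi>"
proof -
  have eq: "\<Phi> (eval_word fs w) = \<Psi> (eval_word fs w)" if "w \<in> lists {..<length fs}" for w
    using that
  proof (induction w)
    case Nil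
    then show ?case
      using \<Phi> \<Psi> by (simp add: is_reversion_def)
  next
    case (Cons i w)
    then have "fs ! i \<in> span (set fs)"
      by (auto intro: span_base)
    with Cons \<Phi> \<Psi> show ?case
      by (auto simp: is_reversion_def anti_automorphism_def)
  qed
  have "\<Phi> X = \<Psi> X" for X
    by (rule linear_eq_on_span[of \<Phi> \<Psi> "eval_word fs ` lists {..<length fs}"])
      (use \<Phi> \<Psi> eq surj in \<open>auto simp: is_reversion_def anti_automorphism_def
        simp del: in_lists_conv_set\<close>)
  then show ?thesis by blast
qed

text \<open>Over a commutative field transposition reverses products, and conjugation by the
  invertible \<open>J\<close> preserves them. Fixing the generators extends to their span by
  linearity.\<close>

lemma is_reversion_conj_transpose:
  fixes J K :: "'a::real_field^'n^'n"
  assumes JK: "J ** K = mat 1" and KJ: "K ** J = mat 1"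
    and fix_gens: "\<And>f. f \<in> set fs \<Longrightarrow> K ** transpose f ** J = f"
  shows "is_reversion fs (\<lambda>X. K ** transpose X ** J)"
proof -
  let ?\<Phi> = "\<lambda>X. K ** transpose X ** J"
  have lin: "linear ?\<Phi>"
  proof (rule linearI)
    fix X Y :: "'a^'n^'n" and r :: real
    have "transpose (X + Y) = transpose X + transpose Y"
      and "transpose (r *\<^sub>R X) = r *\<^sub>R transpose X"
      by (simp_all add: vec_eq_iff transpose_def)
    then show "?\<Phi> (X + Y) = ?\<Phi> X + ?\<Phi> Y" "?\<Phi> (r *\<^sub>R X) = r *\<^sub>R ?\<Phi> X"
      by (simp_all add: matrix_add_ldistrib linear_add[OF linear_matrix_mult_left]
          scaleR_matrix_mult_left scaleR_matrix_mult_right)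
  qed
  have mult: "?\<Phi> (X ** Y) = ?\<Phi> Y ** ?\<Phi> X" for X Y
  proof -
    have "?\<Phi> Y ** ?\<Phi> X = K ** transpose Y ** (J ** K) ** transpose X ** J"
      by (simp only: matrix_mul_assoc)
    then show ?thesis
      by (simp add: JK matrix_transpose_mul matrix_mul_assoc)
  qed
  have bij: "bij ?\<Phi>"
  proof (rule o_bij)
    \<comment> \<open>The inverse map undoes the conjugation first and then transposes.\<close>
    let ?\<Psi> = "\<lambda>X. transpose (J ** X ** K)"
    have "J ** (K ** A ** J) ** K = (J ** K) ** A ** (J ** K)"
      and "K ** (J ** A ** K) ** J = (K ** J) ** A ** (K ** J)" for A
      by (simp_all only: matrix_mul_assoc)
    then show "?\<Psi> \<circ> ?\<Phi> = id" "?\<Phi> \<circ> ?\<Psi> = id"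
      by (simp_all add: fun_eq_iff JK KJ)
  qed
  have "?\<Phi> v = v" if "v \<in> span (set fs)" for v
    by (rule linear_eq_on[OF lin linear_id[unfolded id_def] that]) (rule fix_gens)
  moreover have "?\<Phi> (mat 1) = mat 1"
    by (simp add: KJ)
  ultimately show ?thesis
    using lin bij mult by (simp add: is_reversion_def anti_automorphism_def)
qed


section \<open>The given 1-vectors\<close>

lemma fhat_entries:
  "fhat_1 = vector [vector [0, \<i>, 0, 0], vector [\<i>, 0, 0, 0],
     vector [0, 0, 0, - \<i>], vector [0, 0, - \<i>, 0]]"
  "fhat_2 = vector [vector [\<i>, 0, 0, 0], vector [0, - \<i>, 0, 0],
     vector [0, 0, \<i>, 0], vector [0, 0, 0, - \<i>]]"
  "fhat_3 = vector [vector [0, - 1, 0, 0], vector [1, 0, 0, 0],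
     vector [0, 0, 0, - 1], vector [0, 0, 1, 0]]"
  "fhat_4 = vector [vector [0, 0, 0, - \<i>], vector [0, 0, - \<i>, 0],
     vector [0, - \<i>, 0, 0], vector [- \<i>, 0, 0, 0]]"
  "fhat_5 = vector [vector [0, 0, 0, 1], vector [0, 0, 1, 0],
     vector [0, - 1, 0, 0], vector [- 1, 0, 0, 0]]"
  by (simp_all add: vec_eq_iff forall_4 vector_4 vector_2 fhat_1_def fhat_2_def fhat_3_def
      fhat_4_def fhat_5_def kronecker_def block_index_def inner_index_def map_matrix_def
      sigma_x_def sigma_y_def sigma_z_def mat_def)

text \<open>The columns are the coordinates of j1 = j, ji = -k, jj = -1 and jk = i.\<close>

lemma J_breve_entries:
  "J_breve = vector [vector [0, 0, - 1, 0], vector [0, 0, 0, 1],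
     vector [1, 0, 0, 0], vector [0, - 1, 0, 0]]"
  by (simp add: vec_eq_iff forall_4 vector_4 J_breve_def map_matrix_def quat_tensor_matrix_def
      matrix_def quat_mult_def quat_cnj_def quat_j_def quat_1_def axis_def)

lemmas entrywise = vec_eq_iff forall_4 vector_4 matrix_matrix_mult_def sum_4 mat_def transpose_def

section \<open>Clifford relations for the given matrices\<close>

lemma fhat_squares:
  "fhat_1 ** fhat_1 = - mat 1" "fhat_2 ** fhat_2 = - mat 1" "fhat_3 ** fhat_3 = - mat 1"
  "fhat_4 ** fhat_4 = - mat 1" "fhat_5 ** fhat_5 = - mat 1"
  by (simp_all add: fhat_entries entrywise)

text \<open>One equation per unordered pair is enough: rewriting with it proves the opposite order
  through a double negation.\<close>

lemma fhat_anticommute: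
  "fhat_1 ** fhat_2 = - (fhat_2 ** fhat_1)" "fhat_1 ** fhat_3 = - (fhat_3 ** fhat_1)"
  "fhat_1 ** fhat_4 = - (fhat_4 ** fhat_1)" "fhat_1 ** fhat_5 = - (fhat_5 ** fhat_1)"
  "fhat_2 ** fhat_3 = - (fhat_3 ** fhat_2)" "fhat_2 ** fhat_4 = - (fhat_4 ** fhat_2)"
  "fhat_2 ** fhat_5 = - (fhat_5 ** fhat_2)" "fhat_3 ** fhat_4 = - (fhat_4 ** fhat_3)"
  "fhat_3 ** fhat_5 = - (fhat_5 ** fhat_3)" "fhat_4 ** fhat_5 = - (fhat_5 ** fhat_4)"
  by (simp_all add: fhat_entries entrywise)

lemma fhat_nth:
  "fhat ! 0 = fhat_1" "fhat ! Suc 0 = fhat_2" "fhat ! 2 = fhat_3" "fhat ! 3 = fhat_4"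
  "fhat ! 4 = fhat_5"
  by (simp_all add: fhat_def)

lemma less_5_cases: "i < (5::nat) \<longleftrightarrow> i = 0 \<or> i = 1 \<or> i = 2 \<or> i = 3 \<or> i = 4"
  by auto

section \<open>Generation of the full matrix algebra\<close>

text \<open>The imaginary unit enters as the factor \<open>mat \<i>\<close>, because a real
  subalgebra allows only real scaling and products.\<close>

lemma complex_matrix_eq_sum_units:
  fixes X :: "complex^'n^'n"
  shows "X = (\<Sum>a\<in>UNIV. \<Sum>b\<in>UNIV.
      Re (X $ a $ b) *\<^sub>R (\<chi> i j. if i = a \<and> j = b then 1 else 0)
      + Im (X $ a $ b) *\<^sub>R (mat \<i> ** (\<chi> i j. if i = a \<and> j = b then 1 else 0)))"
proof -
  have mat_mult: "(mat c ** A) $ i $ j = c * A $ i $ j" for c i j and A :: "complex^'n^'n"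
    by (simp add: matrix_matrix_mult_def mat_def if_distrib[of "\<lambda>x. x * _"] cong: if_cong)
  \<comment> \<open>The conditions are nested so that the inner sum over columns collapses first and
    the sum over rows second.\<close>
  have entry: "Re c *\<^sub>R (if P \<and> Q then 1 else 0) + Im c *\<^sub>R (\<i> * (if P \<and> Q then 1 else 0))
      = (if Q then if P then c else 0 else 0)" for c P Q
    by (simp add: complex_eq_iff)
  show ?thesis
    by (simp add: vec_eq_iff mat_mult entry)
qed

text \<open>The products below are \<open>\<i> 1\<close>, \<open>1 \<otimes> \<sigma>\<^sub>x\<close>, \<open>1 \<otimes> \<sigma>\<^sub>z\<close>, \<open>\<sigma>\<^sub>z \<otimes> 1\<close> and \<open>\<sigma>\<^sub>x \<otimes> 1\<close>;
  \<open>\<sigma>\<^sub>z\<close> provides the projection to the first basis vector, \<open>\<sigma>\<^sub>x\<close> the shifts.\<close>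

lemma span_eval_word_fhat: "span (eval_word fhat ` lists {..<5}) = UNIV"
proof -
  define S where "S = span (eval_word fhat ` lists {..<5})"
  have mult: "A ** B \<in> S" if "A \<in> S" "B \<in> S" for A B
    using span_eval_word_mult that unfolding S_def .
  have add: "A + B \<in> S" if "A \<in> S" "B \<in> S" for A B
    using span_add that unfolding S_def .
  have neg: "- A \<in> S" if "A \<in> S" for A
    using span_neg that unfolding S_def .
  have scale: "r *\<^sub>R A \<in> S" if "A \<in> S" for r A
    using span_scale that unfolding S_def .
  have one: "mat 1 \<in> S"
    unfolding S_def by (rule span_base, rule image_eqI[of _ _ "[]"]) simp_all
  have gen: "fhat ! i \<in> S" if "i < 5" for i
    unfolding S_def using that
    by (intro span_base image_eqI[of _ _ "[i]"]) simp_all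
  have gens: "fhat_1 \<in> S" "fhat_2 \<in> S" "fhat_3 \<in> S" "fhat_4 \<in> S" "fhat_5 \<in> S"
    using gen[of 0] gen[of 1] gen[of 2] gen[of 3] gen[of 4] by (simp_all add: fhat_nth)
  define x2 where "x2 = - (fhat_1 ** (fhat_4 ** fhat_5))"
  \<comment> \<open>By the choice of \<open>x2\<close> the right side is the product of all five
    generators, in the order 1, 4, 5, 2, 3. This central element supplies the complex
    scalars.\<close>
  have "mat \<i> = - (x2 ** (fhat_2 ** fhat_3))"
    by (simp add: x2_def fhat_entries entrywise)
  then have x2: "x2 \<in> S" and imag: "mat \<i> \<in> S"
    using gens by (auto simp: x2_def intro!: mult neg)
  \<comment> \<open>The factor \<open>mat \<i>\<close> turns the imaginary coefficient of a
    generator into a real one; in \<open>z1\<close> and \<open>x1\<close> the factor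
    \<open>x2\<close> also cancels the second tensor factor \<open>sigma_x\<close>.\<close>
  define z2 where "z2 = - (mat \<i> ** fhat_2)"
  define z1 where "z1 = - (mat \<i> ** (fhat_1 ** x2))"
  define x1 where "x1 = mat \<i> ** (fhat_4 ** x2)"
  have xz: "x1 \<in> S" "z1 \<in> S" "z2 \<in> S"
    unfolding x1_def z1_def z2_def using gens x2 imag by (auto intro!: mult neg)
  have entries:
    "x2 = vector [vector [0, 1, 0, 0], vector [1, 0, 0, 0],
      vector [0, 0, 0, 1], vector [0, 0, 1, 0]]"
    "x1 = vector [vector [0, 0, 1, 0], vector [0, 0, 0, 1],
      vector [1, 0, 0, 0], vector [0, 1, 0, 0]]"
    "z2 = vector [vector [1, 0, 0, 0], vector [0, - 1, 0, 0],
      vector [0, 0, 1, 0], vector [0, 0, 0, - 1]]"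
    "z1 = vector [vector [1, 0, 0, 0], vector [0, 1, 0, 0],
      vector [0, 0, - 1, 0], vector [0, 0, 0, - 1]]"
    by (simp_all add: x1_def x2_def z1_def z2_def fhat_entries entrywise)
  \<comment> \<open>The two factors are twice the projections onto the +1 eigenspaces of
    \<open>z1\<close> and \<open>z2\<close>, which meet in the line of the first basis
    vector.\<close>
  define E where "E = (1/4) *\<^sub>R ((mat 1 + z1) ** (mat 1 + z2))"
  have E: "E \<in> S"
    unfolding E_def using xz one by (intro scale mult add)
  have E_entries: "E = vector [vector [1, 0, 0, 0], 0, 0, 0]"
    by (simp add: E_def entries entrywise complex_eq_iff)
  \<comment> \<open>Each \<open>shift a\<close> is a symmetric permutation matrix exchanging basis
    vectors 1 and \<open>a\<close>: from the left it moves the entry of \<open>E\<close> to row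
    \<open>a\<close>, and \<open>shift b\<close> from the right moves it to column
    \<open>b\<close>.\<close>
  define shift where "shift a =
    (if a = 1 then mat 1 else if a = 2 then x2 else if a = 3 then x1 else x1 ** x2)" for a :: 4
  have shift: "shift a \<in> S" for a
    unfolding shift_def using one x2 xz mult by auto
  have "\<forall>a b. shift a ** (E ** shift b) = (\<chi> i j. if i = a \<and> j = b then 1 else 0)"
    by (simp add: shift_def entries E_entries entrywise)
  then have unit: "(\<chi> i j. if i = a \<and> j = b then 1 else 0) \<in> S" for a b
    using shift E mult by metis
  have "X \<in> S" for X
    by (subst complex_matrix_eq_sum_units, unfold S_def,
        intro span_sum, fold S_def, intro add scale mult unit imag)
  then show ?thesis
    by (auto simp: S_def)
qed

section \<open>The Clifford basis and its reversion\<close>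

lemma basis_of_1_vectors_fhat: "basis_of_1_vectors 0 5 fhat"
proof (rule basis_of_1_vectorsI)
  fix i j :: nat
  assume "i < 0 + 5" "j < 0 + 5" "i \<noteq> j"
  then show "fhat ! i ** fhat ! j = - (fhat ! j ** fhat ! i)"
    unfolding add_0 less_5_cases by (elim disjE) (simp_all add: fhat_nth fhat_anticommute)
next
  fix i :: nat
  assume "i < 0 + 5"
  then show "fhat ! i ** fhat ! i = generator_square 0 i *\<^sub>R mat 1"
    unfolding add_0 less_5_cases
    by (elim disjE) (simp_all add: fhat_nth fhat_squares generator_square_def)
\<comment> \<open>Among the remaining conditions is the count of real dimensions, 4 * 4 * 2 = 2 ^
  5.\<close>
qed (simp_all add: fhat_def span_eval_word_fhat[unfolded fhat_def])

theorem theorem7p4: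
  shows "basis_of_1_vectors 0 5 fhat \<and>
    (\<exists>!\<Phi>. is_reversion fhat \<Phi>) \<and>
    (\<forall>X. reversion fhat X = matrix_inv J_breve ** transpose X ** J_breve)"
proof -
  \<comment> \<open>Left multiplication by j squares to -1, so its inverse is its negative.\<close>
  have JJ: "J_breve ** (- J_breve) = mat 1" "(- J_breve) ** J_breve = mat 1"
    by (simp_all add: J_breve_entries entrywise)
  \<comment> \<open>\<open>matrix_inv\<close> is a choice, so only the inverse property can be
    extracted from a witness; comparison with the right inverse \<open>- J_breve\<close> then
    identifies the chosen matrix.\<close>
  have "matrix_inv J_breve ** J_breve = mat 1"
    unfolding matrix_inv_def by (rule someI2[of _ "- J_breve"]) (simp_all add: JJ)
  then have inv: "matrix_inv J_breve = - J_breve"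
    by (metis JJ(1) matrix_mul_assoc matrix_mul_lid matrix_mul_rid)
  let ?\<Phi> = "\<lambda>X. matrix_inv J_breve ** transpose X ** J_breve"
  have rev: "is_reversion fhat ?\<Phi>"
    unfolding inv
  proof (rule is_reversion_conj_transpose[OF JJ])
    fix f assume "f \<in> set fhat"
    then consider "f = fhat_1" | "f = fhat_2" | "f = fhat_3" | "f = fhat_4" | "f = fhat_5"
      by (auto simp: fhat_def)
    \<comment> \<open>\<open>J_breve\<close> commutes with the symmetric matrices
      \<open>fhat_1\<close>, \<open>fhat_2\<close>, \<open>fhat_4\<close> and anticommutes with the
      skew ones \<open>fhat_3\<close>, \<open>fhat_5\<close>, so the signs from transposition and
      conjugation cancel.\<close>
    then show "(- J_breve) ** transpose f ** J_breve = f"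
      by cases (simp_all add: J_breve_entries fhat_entries entrywise)
  qed
  have unique: "\<Phi> = ?\<Phi>" if "is_reversion fhat \<Phi>" for \<Phi>
  proof (rule is_reversion_unique[OF _ that rev])
    have "length fhat = 5"
      by (simp add: fhat_def)
    with span_eval_word_fhat show "span (eval_word fhat ` lists {..<length fhat}) = UNIV"
      by simp
  qed
  have "reversion fhat = ?\<Phi>"
    unfolding reversion_def using rev unique by (rule the_equality)
  with rev unique basis_of_1_vectors_fhat show ?thesis
    by (metis (no_types, lifting))
qed

end
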